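(* Assume that the non-zero mesh points of $\Omega=\{\theta_k: k=0,\dots,N\}$, where $-\tau\le\theta_0<\dots<\theta_{N-1}<\theta_N=0$, are chosen as the zeroes of $\phi_N$, that is, $\phi_N(\theta_k)=0$ for $k=0,\dots,N-1$. Then for any $N$, the pseudospectral collocation approximation on $\Omega$ and the Lanczos tau approximation of the time-delay system $$\dot{\mathbf x}(t)=A_0\mathbf x(t)+A_1\mathbf x(t-\tau)+B\mathbf u(t),\qquad \mathbf y(t)=C\mathbf x(t),$$ are equivalent, i.e. their transfer functions satisfy $J_N(s)=G_N(s)$.
   Context: Let $\tau>0$, $A_0,A_1\in\mathbb C^{n\times n}$, $B\in\mathbb C^{n\times p}$, $C\in\mathbb C^{q\times n}$, and let $N$ be a positive integer. Orthogonal polynomials: let $\langle\cdot,\cdot\rangle$ be an inner product on the space of (complex-valued) polynomials on $[-\tau,0]$, linear in the first and antilinear in the second argument, with induced norm $\|f\|=\sqrt{\langle f,f\rangle}$, and let $\{\phi_k\}_{k\ge0}$ be a degree-graded orthogonal sequence: $\phi_k$ has degree $k$ and $\langle\phi_j,\phi_k\rangle=0$ if and only if $j\ne k$. Lanczos tau approximation: $\mathbb P_N^n$ denotes the $\mathbb C^n$-valued polynomials on $[-\tau,0]$ of degree at most $N$; $\varepsilon_\theta f=f(\theta)$; $\mathcal D f=f'$; $\mathcal T_{N-1}:\mathbb P_N^n\to\mathbb P_{N-1}^n$ acts on each component $f$ by $\mathcal T_{N-1}f=f-\frac{\langle f,\phi_N\rangle}{\|\phi_N\|^2}\phi_N$;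 $\mathbf 0$ is the zero polynomial. The approximation is the system for $\xi_{tN}\in\mathbb P_N^n$ $$\begin{pmatrix}\varepsilon_0\\ \mathcal T_{N-1}\end{pmatrix}\tfrac{d}{dt}\xi_{tN}=\begin{pmatrix}A_0\varepsilon_0+A_1\varepsilon_{-\tau}\\ \mathcal D\end{pmatrix}\xi_{tN}+\begin{pmatrix}B\\ \mathbf 0\end{pmatrix}\mathbf u(t),\qquad \mathbf y_N(t)=C\varepsilon_0\xi_{tN},$$ with transfer function $$G_N(s)=C\,\varepsilon_0\begin{pmatrix} s\varepsilon_0-A_0\varepsilon_0-A_1\varepsilon_{-\tau}\\ s\mathcal T_{N-1}-\mathcal D\end{pmatrix}^{-1}\begin{pmatrix}B\\ \mathbf 0\end{pmatrix}.$$ Pseudospectral collocation: let $\ell_0,\dots,\ell_N$ be the Lagrange polynomials of degree $N$ on $\Omega$, with $\ell_k(\theta_j)=\delta_{jk}$. Define the block matrix $\mathcal A_N\in\mathbb C^{n(N+1)\times n(N+1)}$ with $n\times n$ blocks (rows $j$, columns $k$ in $0,\dots,N$): $(\mathcal A_N)_{jk}=\ell_k'(\theta_j)I_n$ for $j=0,\dots,N-1$, and $(\mathcal A_N)_{Nk}=A_0\ell_k(0)+A_1\ell_k(-\tau)$. Let $\mathcal B_N$ be the block column with last block $B$ and other blocks zero, and $\mathcal C_N$ the block row with last block $C$ and other blocks zero. The approximation is $\dot{\mathbf x}_N(t)=\mathcal A_N\mathbf x_N(t)+\mathcal B_N\mathbf u(t)$, $\mathbf y_N(t)=\mathcal C_N\mathbf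 x_N(t)$, with transfer function $J_N(s)=\mathcal C_N(sI_{n(N+1)}-\mathcal A_N)^{-1}\mathcal B_N$. *)

theory Defs
  imports "HOL-Computational_Algebra.Polynomial" "Jordan_Normal_Form.Gauss_Jordan_Elimination"
begin

hide_const (open) Module.smult

text \<open>
  Since \<open>\<tau> > 0\<close>, a complex polynomial function on the real interval \<open>[-\<tau>, 0]\<close> determines its
  coefficients, so such functions are represented by \<^typ>\<open>complex poly\<close>, and
  \<open>\<complex>\<^sup>n\<close>-valued ones by vectors of dimension \<open>n\<close> over \<^typ>\<open>complex poly\<close>.
\<close>

definition poly_inner_product :: "(complex poly \<Rightarrow> complex poly \<Rightarrow> complex) \<Rightarrow> bool" where
  "poly_inner_product ip \<longleftrightarrow>
     (\<forall>f g h. ip (f + g) h = ip f h + ip g h) \<and>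
     (\<forall>c f g. ip (smult c f) g = c * ip f g) \<and>
     (\<forall>f g. ip g f = cnj (ip f g)) \<and>
     (\<forall>f. f \<noteq> 0 \<longrightarrow> Re (ip f f) > 0)"

definition ip_norm :: "(complex poly \<Rightarrow> complex poly \<Rightarrow> complex) \<Rightarrow> complex poly \<Rightarrow> real" where
  "ip_norm ip f = sqrt (Re (ip f f))"

text \<open>For \<open>k = 0\<close> the degree condition alone would allow \<open>\<phi> 0 = 0\<close>, but the
  orthogonality condition gives \<open>ip (\<phi> 0) (\<phi> 0) \<noteq> 0\<close>.\<close>

definition degree_graded_orthogonal ::
  "(complex poly \<Rightarrow> complex poly \<Rightarrow> complex) \<Rightarrow> (nat \<Rightarrow> complex poly) \<Rightarrow> bool" where
  "degree_graded_orthogonal ip \<phi> \<longleftrightarrow>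
     (\<forall>k. degree (\<phi> k) = k) \<and> (\<forall>j k. ip (\<phi> j) (\<phi> k) = 0 \<longleftrightarrow> j \<noteq> k)"


subsection \<open>Lanczos tau approximation\<close>

definition vpolys :: "nat \<Rightarrow> nat \<Rightarrow> complex poly vec set" where
  "vpolys n N = {f \<in> carrier_vec n. \<forall>i<n. degree (f $ i) \<le> N}"

definition eval_at :: "real \<Rightarrow> complex poly vec \<Rightarrow> complex vec" where
  "eval_at \<theta> f = map_vec (\<lambda>g. poly g (complex_of_real \<theta>)) f"

definition vderiv :: "complex poly vec \<Rightarrow> complex poly vec" where
  "vderiv f = map_vec pderiv f"

text \<open>\<open>vtrunc ip (\<phi> N)\<close> is the truncation \<open>\<T>\<^bsub>N-1\<^esub>\<close>.\<close>

definition vtrunc ::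
  "(complex poly \<Rightarrow> complex poly \<Rightarrow> complex) \<Rightarrow> complex poly \<Rightarrow> complex poly vec \<Rightarrow> complex poly vec" where
  "vtrunc ip \<psi> f =
     map_vec (\<lambda>g. g - smult (ip g \<psi> / complex_of_real ((ip_norm ip \<psi>)\<^sup>2)) \<psi>) f"

text \<open>The operator
  \<open>(s \<epsilon>\<^sub>0 - A0 \<epsilon>\<^sub>0 - A1 \<epsilon>\<^bsub>-\<tau>\<^esub> ; s \<T>\<^bsub>N-1\<^esub> - \<D>)\<close>
  from \<open>vpolys n N\<close> to \<open>\<complex>\<^sup>n \<times> vpolys n (N - 1)\<close>;
  the scalar \<open>s\<close> is the constant polynomial \<open>[:s:]\<close> in the second component.\<close>

definition tau_operator ::
  "real \<Rightarrow> complex mat \<Rightarrow> complex mat \<Rightarrow> (complex poly \<Rightarrow> complex poly \<Rightarrow> complex)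
   \<Rightarrow> (nat \<Rightarrow> complex poly) \<Rightarrow> nat \<Rightarrow> complex \<Rightarrow> complex poly vec \<Rightarrow> complex vec \<times> complex poly vec" where
  "tau_operator \<tau> A0 A1 ip \<phi> N s f =
     (s \<cdot>\<^sub>v eval_at 0 f - A0 *\<^sub>v eval_at 0 f - A1 *\<^sub>v eval_at (- \<tau>) f,
      [:s:] \<cdot>\<^sub>v vtrunc ip (\<phi> N) f - vderiv f)"

text \<open>Transfer functions are partial functions of \<open>s\<close>: they are undefined exactly where the
  operator, respectively the matrix, to be inverted is not invertible. The linear map
  \<open>\<complex>\<^sup>p \<rightarrow> \<complex>\<^sup>q\<close> obtained from the tau approximation is identified with its
  \<open>q \<times> p\<close> matrix with respect to the standard bases.\<close>

definition tau_transfer ::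
  "nat \<Rightarrow> nat \<Rightarrow> nat \<Rightarrow> real \<Rightarrow> complex mat \<Rightarrow> complex mat \<Rightarrow> complex mat \<Rightarrow> complex mat
   \<Rightarrow> (complex poly \<Rightarrow> complex poly \<Rightarrow> complex) \<Rightarrow> (nat \<Rightarrow> complex poly) \<Rightarrow> nat
   \<Rightarrow> complex \<Rightarrow> complex mat option" where
  "tau_transfer n p q \<tau> A0 A1 B C ip \<phi> N s =
     (let L = tau_operator \<tau> A0 A1 ip \<phi> N s in
      if bij_betw L (vpolys n N) (carrier_vec n \<times> vpolys n (N - 1))
      then Some (mat q p (\<lambda>(i, j).
        (C *\<^sub>v eval_at 0 (the_inv_into (vpolys n N) L (B *\<^sub>v unit_vec p j, 0\<^sub>v n))) $ i))
      else None)"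


subsection \<open>Pseudospectral collocation\<close>

definition lagrange_poly :: "(nat \<Rightarrow> real) \<Rightarrow> nat \<Rightarrow> nat \<Rightarrow> complex poly" where
  "lagrange_poly \<theta> N k =
     (\<Prod>j\<in>{..N} - {k}. smult (inverse (complex_of_real (\<theta> k - \<theta> j))) [:- complex_of_real (\<theta> j), 1:])"

lemma poly_lagrange_poly:
  assumes "inj_on \<theta> {..N}" "k \<le> N" "j \<le> N"
  shows "poly (lagrange_poly \<theta> N k) (complex_of_real (\<theta> j)) = (if j = k then 1 else 0)"
proof (cases "j = k")
  case True
  have "inverse (complex_of_real (\<theta> k - \<theta> i)) * (complex_of_real (\<theta> k) - complex_of_real (\<theta> i)) = 1"
    if "i \<in> {..N} - {k}" for i
  proof -
    have "\<theta> k - \<theta> i \<noteq> 0" using that assms by (auto dest: inj_onD)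
    then show ?thesis by (simp flip: of_real_diff)
  qed
  then show ?thesis using True
    by (simp add: lagrange_poly_def poly_prod algebra_simps)
next
  case False
  then have "j \<in> {..N} - {k}" using assms by auto
  then show ?thesis using False
    by (auto simp: lagrange_poly_def poly_prod intro!: prod_zero bexI[of _ j])
qed

lemma degree_lagrange_poly:
  assumes "inj_on \<theta> {..N}" "k \<le> N"
  shows "degree (lagrange_poly \<theta> N k) = N"
proof -
  have nz: "complex_of_real (\<theta> k - \<theta> i) \<noteq> 0" if "i \<in> {..N} - {k}" for i
    using that assms by (auto dest: inj_onD)
  have "degree (lagrange_poly \<theta> N k) =
    (\<Sum>j\<in>{..N} - {k}. degree (smult (inverse (complex_of_real (\<theta> k - \<theta> j))) [:- complex_of_real (\<theta> j), 1:]))"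
    unfolding lagrange_poly_def using nz by (intro degree_prod_eq_sum_degree) auto
  also have "\<dots> = (\<Sum>j\<in>{..N} - {k}. 1)"
    using nz by (intro sum.cong) auto
  also have "\<dots> = N" using assms(2) by simp
  finally show ?thesis .
qed

text \<open>\<open>block_mat a b R K blk\<close> has \<open>R \<times> K\<close> blocks, each of size \<open>a \<times> b\<close>;
  \<open>blk j k\<close> is the block in block row \<open>j\<close> and block column \<open>k\<close>.\<close>

definition block_mat :: "nat \<Rightarrow> nat \<Rightarrow> nat \<Rightarrow> nat \<Rightarrow> (nat \<Rightarrow> nat \<Rightarrow> complex mat) \<Rightarrow> complex mat" where
  "block_mat a b R K blk =
     mat (a * R) (b * K) (\<lambda>(r, c). blk (r div a) (c div b) $$ (r mod a, c mod b))"

definition colloc_A ::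
  "nat \<Rightarrow> real \<Rightarrow> complex mat \<Rightarrow> complex mat \<Rightarrow> (nat \<Rightarrow> real) \<Rightarrow> nat \<Rightarrow> complex mat" where
  "colloc_A n \<tau> A0 A1 \<theta> N = block_mat n n (N + 1) (N + 1) (\<lambda>j k.
     if j < N then poly (pderiv (lagrange_poly \<theta> N k)) (complex_of_real (\<theta> j)) \<cdot>\<^sub>m 1\<^sub>m n
     else poly (lagrange_poly \<theta> N k) 0 \<cdot>\<^sub>m A0
          + poly (lagrange_poly \<theta> N k) (complex_of_real (- \<tau>)) \<cdot>\<^sub>m A1)"

definition colloc_B :: "nat \<Rightarrow> nat \<Rightarrow> complex mat \<Rightarrow> nat \<Rightarrow> complex mat" where
  "colloc_B n p B N = block_mat n p (N + 1) 1 (\<lambda>j _. if j = N then B else 0\<^sub>m n p)"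

definition colloc_C :: "nat \<Rightarrow> nat \<Rightarrow> complex mat \<Rightarrow> nat \<Rightarrow> complex mat" where
  "colloc_C n q C N = block_mat q n 1 (N + 1) (\<lambda>_ k. if k = N then C else 0\<^sub>m q n)"

text \<open>\<^const>\<open>mat_inverse\<close> yields \<^const>\<open>None\<close> exactly for singular matrices.\<close>

definition colloc_transfer ::
  "nat \<Rightarrow> nat \<Rightarrow> nat \<Rightarrow> real \<Rightarrow> complex mat \<Rightarrow> complex mat \<Rightarrow> complex mat \<Rightarrow> complex mat
   \<Rightarrow> (nat \<Rightarrow> real) \<Rightarrow> nat \<Rightarrow> complex \<Rightarrow> complex mat option" where
  "colloc_transfer n p q \<tau> A0 A1 B C \<theta> N s =
     map_option (\<lambda>R. colloc_C n q C N * R * colloc_B n p B N)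
       (mat_inverse (s \<cdot>\<^sub>m 1\<^sub>m (n * (N + 1)) - colloc_A n \<tau> A0 A1 \<theta> N))"

end

theory Submission
  imports Defs "Jordan_Normal_Form.Determinant"
begin

text \<open>
  Sampling at the mesh points identifies \<open>vpolys n N\<close> with \<open>\<complex>\<close>-vectors of length \<open>n (N + 1)\<close>, and
  sampling at the \<open>N\<close> non-zero mesh points identifies \<open>vpolys n (N - 1)\<close> with vectors of length
  \<open>n N\<close>. The truncation changes a polynomial by a multiple of \<open>\<phi> N\<close>, which vanishes at the non-zero
  mesh points, so it is invisible after sampling: in these coordinates the operator of the tau
  approximation is exactly the matrix \<open>s I - \<A>\<^sub>N\<close> of the collocation method.
\<close>

hide_const (open) Module.smult

section \<open>Block decomposition of indices, vectors and matrices\<close>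

lemma block_index_less:
  fixes a i j R :: nat
  assumes "i < a" "j < R"
  shows "a * j + i < a * R"
proof -
  have "a * j + i < a * Suc j" using assms(1) by simp
  also have "\<dots> \<le> a * R" using assms(2) by (intro mult_le_mono2) simp
  finally show ?thesis .
qed

lemma sum_blocks:
  fixes g :: "nat \<Rightarrow> 'a::comm_monoid_add"
  shows "(\<Sum>c = 0..<b * K. g c) = (\<Sum>k<K. \<Sum>m<b. g (b * k + m))"
proof (induction K)
  case (Suc K)
  have "(\<Sum>c = 0..<b * Suc K. g c) = (\<Sum>c = 0..<b * K. g c) + (\<Sum>c = b * K..<b * K + b. g c)"
    by (subst sum.atLeastLessThan_concat) (auto simp: algebra_simps)
  also have "(\<Sum>c = b * K..<b * K + b. g c) = (\<Sum>m<b. g (b * K + m))"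
    using sum.shift_bounds_nat_ivl[of g 0 "b * K" b]
    by (simp add: lessThan_atLeast0 add.commute)
  finally show ?case using Suc by simp
qed simp

lemma block_vec_eqI:
  assumes "u \<in> carrier_vec (n * K)" "v \<in> carrier_vec (n * K)"
    and "\<And>k i. k < K \<Longrightarrow> i < n \<Longrightarrow> u $ (n * k + i) = v $ (n * k + i)"
  shows "u = v"
proof (rule eq_vecI)
  fix r assume "r < dim_vec v"
  then have r: "r < n * K" using assms(2) by simp
  \<comment> \<open>Positivity gives \<open>r mod n < n\<close>; for \<open>n = 0\<close> there are
    no entries to compare.\<close>
  then have n: "n > 0" by (cases n) auto
  have "r div n < K" using r by (simp add: less_mult_imp_div_less mult.commute)
  then have "u $ (n * (r div n) + r mod n) = v $ (n * (r div n) + r mod n)"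
    using n by (intro assms(3)) auto
  then show "u $ r = v $ r" by simp
qed (use assms in auto)

lemma block_mat_carrier [simp]: "block_mat a b R K blk \<in> carrier_mat (a * R) (b * K)"
  by (simp add: block_mat_def)

lemma dim_block_mat [simp]:
  "dim_row (block_mat a b R K blk) = a * R" "dim_col (block_mat a b R K blk) = b * K"
  by (simp_all add: block_mat_def)

lemma block_mat_index:
  assumes "i < a" "m < b" "j < R" "k < K"
  shows "block_mat a b R K blk $$ (a * j + i, b * k + m) = blk j k $$ (i, m)"
  using assms by (simp add: block_mat_def block_index_less)

lemma block_mat_mult_vec_index:
  assumes "v \<in> carrier_vec (b * K)" "i < a" "j < R"
  shows "(block_mat a b R K blk *\<^sub>v v) $ (a * j + i) =
    (\<Sum>k<K. \<Sum>m<b. blk j k $$ (i, m) * v $ (b * k + m))"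
proof -
  have r: "a * j + i < a * R" using assms by (intro block_index_less)
  have "(block_mat a b R K blk *\<^sub>v v) $ (a * j + i) =
      (\<Sum>c = 0..<b * K. block_mat a b R K blk $$ (a * j + i, c) * v $ c)"
    using r assms(1) by (auto simp: scalar_prod_def intro!: sum.cong)
  also have "\<dots> = (\<Sum>k<K. \<Sum>m<b. block_mat a b R K blk $$ (a * j + i, b * k + m) * v $ (b * k + m))"
    by (rule sum_blocks)
  also have "\<dots> = (\<Sum>k<K. \<Sum>m<b. blk j k $$ (i, m) * v $ (b * k + m))"
    using assms by (intro sum.cong refl) (simp add: block_mat_index)
  finally show ?thesis .
qed

text \<open>Puts the definedness of the collocation transfer function into the form used for the tau
  approximation. An injective square matrix map has trivial kernel, hence non-zero determinant,
  hence an inverse.\<close>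

lemma mat_inverse_Some_iff_bij:
  fixes M :: "'a::field mat"
  assumes M: "M \<in> carrier_mat n n"
  shows "mat_inverse M \<noteq> None \<longleftrightarrow> bij_betw (\<lambda>x. M *\<^sub>v x) (carrier_vec n) (carrier_vec n)"
proof
  assume "mat_inverse M \<noteq> None"
  then obtain R where "mat_inverse M = Some R" by auto
  from mat_inverse(2)[OF M this]
  have R: "M * R = 1\<^sub>m n" "R * M = 1\<^sub>m n" "R \<in> carrier_mat n n" by auto
  show "bij_betw (\<lambda>x. M *\<^sub>v x) (carrier_vec n) (carrier_vec n)"
  proof (rule bij_betw_byWitness[where f' = "\<lambda>x. R *\<^sub>v x"])
    show "\<forall>x\<in>carrier_vec n. R *\<^sub>v (M *\<^sub>v x) = x"
      using R M by (simp flip: assoc_mult_mat_vec)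
    show "\<forall>x\<in>carrier_vec n. M *\<^sub>v (R *\<^sub>v x) = x"
      using R M by (simp flip: assoc_mult_mat_vec)
  qed (use R M in \<open>auto intro: mult_mat_vec_carrier\<close>)
next
  assume bij: "bij_betw (\<lambda>x. M *\<^sub>v x) (carrier_vec n) (carrier_vec n)"
  have M0: "M *\<^sub>v 0\<^sub>v n = 0\<^sub>v n" using M by (intro eq_vecI) auto
  have "v = 0\<^sub>v n" if "v \<in> carrier_vec n" "M *\<^sub>v v = 0\<^sub>v n" for v
    using inj_onD[OF bij_betw_imp_inj_on[OF bij], of v "0\<^sub>v n"] that M0 by simp
  then have "det M \<noteq> 0" using det_0_iff_vec_prod_zero[OF M] by blast
  then show "mat_inverse M \<noteq> None"
    \<comment> \<open>The dummy \<open>()\<close> fixes the extra parameter of the matrix ring, so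
      that both facts speak of the same set of units.\<close>
    using mat_inverse(1)[OF M, of "()"] det_non_zero_imp_unit[OF M, of "()"] by blast
qed

section \<open>Lagrange interpolation\<close>

text \<open>Both sides have degree at most \<open>N\<close> and agree at \<open>N + 1\<close>
  distinct nodes.\<close>

lemma lagrange_interpolation:
  assumes inj: "inj_on \<theta> {..N}" and deg: "degree f \<le> N"
  shows "f = (\<Sum>k\<le>N. smult (poly f (complex_of_real (\<theta> k))) (lagrange_poly \<theta> N k))"
proof (rule poly_eqI_degree[where A = "(\<lambda>k. complex_of_real (\<theta> k)) ` {..N}"])
  have "inj_on (\<lambda>k. complex_of_real (\<theta> k)) {..N}"
    using inj by (auto simp: inj_on_def)
  then have card: "card ((\<lambda>k. complex_of_real (\<theta> k)) ` {..N}) = Suc N"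
    by (simp add: card_image)
  then show "degree f < card ((\<lambda>k. complex_of_real (\<theta> k)) ` {..N})" using deg by simp
  have "degree (\<Sum>k\<le>N. smult (poly f (complex_of_real (\<theta> k))) (lagrange_poly \<theta> N k)) \<le> N"
    using inj by (intro degree_sum_le order_trans[OF degree_smult_le]) (auto simp: degree_lagrange_poly)
  then show "degree (\<Sum>k\<le>N. smult (poly f (complex_of_real (\<theta> k))) (lagrange_poly \<theta> N k))
      < card ((\<lambda>k. complex_of_real (\<theta> k)) ` {..N})"
    using card by simp
next
  fix x assume "x \<in> (\<lambda>k. complex_of_real (\<theta> k)) ` {..N}"
  then obtain j where j: "j \<le> N" "x = complex_of_real (\<theta> j)" by auto
  have "poly (\<Sum>k\<le>N. smult (poly f (complex_of_real (\<theta> k))) (lagrange_poly \<theta> N k)) x =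
      (\<Sum>k\<le>N. if k = j then poly f (complex_of_real (\<theta> k)) else 0)"
    unfolding poly_sum using j inj by (intro sum.cong) (auto simp: poly_lagrange_poly)
  then show "poly f x = poly (\<Sum>k\<le>N. smult (poly f (complex_of_real (\<theta> k))) (lagrange_poly \<theta> N k)) x"
    using j by simp
qed

lemma poly_lagrange_interpolation:
  assumes "inj_on \<theta> {..N}" "degree f \<le> N"
  shows "poly f x = (\<Sum>k<N + 1. poly (lagrange_poly \<theta> N k) x * poly f (complex_of_real (\<theta> k)))"
  using arg_cong[OF lagrange_interpolation[OF assms], of "\<lambda>g. poly g x"]
  by (simp add: poly_sum lessThan_Suc_atMost[symmetric] mult.commute del: sum.lessThan_Suc)

text \<open>Differentiating the interpolation formula shows that the collocation differentiation
  matrix is exact on polynomials of degree at most \<open>N\<close>.\<close>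

lemma poly_pderiv_lagrange_interpolation:
  assumes "inj_on \<theta> {..N}" "degree f \<le> N"
  shows "poly (pderiv f) x =
    (\<Sum>k<N + 1. poly (pderiv (lagrange_poly \<theta> N k)) x * poly f (complex_of_real (\<theta> k)))"
proof -
  have "pderiv f = (\<Sum>k\<le>N. smult (poly f (complex_of_real (\<theta> k))) (pderiv (lagrange_poly \<theta> N k)))"
    using arg_cong[OF lagrange_interpolation[OF assms], of pderiv]
    \<comment> \<open>The instance for order 1 says that \<open>pderiv\<close> commutes with finite
      sums.\<close>
    by (simp add: higher_pderiv_sum[of 1, simplified] pderiv_smult)
  from arg_cong[OF this, of "\<lambda>g. poly g x"] show ?thesis
    by (simp add: poly_sum lessThan_Suc_atMost[symmetric] mult.commute del: sum.lessThan_Suc)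
qed

section \<open>Sampling as a change of coordinates\<close>

text \<open>Values are grouped by node rather than by component, to match the block order of
  \<open>colloc_A\<close>.\<close>

definition sample :: "(nat \<Rightarrow> real) \<Rightarrow> nat \<Rightarrow> nat \<Rightarrow> complex poly vec \<Rightarrow> complex vec" where
  "sample \<theta> n N f =
     vec (n * (N + 1)) (\<lambda>r. poly (f $ (r mod n)) (complex_of_real (\<theta> (r div n))))"

lemma sample_carrier [simp]: "sample \<theta> n N f \<in> carrier_vec (n * (N + 1))"
  by (simp add: sample_def)

lemma sample_index:
  assumes "i < n" "k < N + 1"
  shows "sample \<theta> n N f $ (n * k + i) = poly (f $ i) (complex_of_real (\<theta> k))"
  using block_index_less[OF assms] assms by (simp add: sample_def)

lemma bij_betw_sample:
  assumes inj: "inj_on \<theta> {..N}"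
  shows "bij_betw (sample \<theta> n N) (vpolys n N) (carrier_vec (n * (N + 1)))"
proof -
  \<comment> \<open>\<open>U\<close> interpolates each component through the given node values; it
    is the inverse of sampling.\<close>
  define U where
    "U x = vec n (\<lambda>i. \<Sum>k\<le>N. smult (x $ (n * k + i)) (lagrange_poly \<theta> N k))" for x
  have U: "U x \<in> vpolys n N" for x
    using inj
    by (auto simp: U_def vpolys_def degree_lagrange_poly
        intro!: degree_sum_le order_trans[OF degree_smult_le])
  show ?thesis
  proof (rule bij_betw_byWitness[where f' = U])
    show "\<forall>f\<in>vpolys n N. U (sample \<theta> n N f) = f"
    proof
      fix f assume f: "f \<in> vpolys n N"
      show "U (sample \<theta> n N f) = f"
      proof (rule eq_vecI)
        fix i assume "i < dim_vec f"
        then have i: "i < n" using f by (auto simp: vpolys_def)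
        then have "degree (f $ i) \<le> N" using f by (auto simp: vpolys_def)
        from lagrange_interpolation[OF inj this]
        show "U (sample \<theta> n N f) $ i = f $ i" using i by (simp add: U_def sample_index)
      qed (use f in \<open>auto simp: vpolys_def U_def\<close>)
    qed
    show "\<forall>x\<in>carrier_vec (n * (N + 1)). sample \<theta> n N (U x) = x"
    proof
      fix x :: "complex vec" assume x: "x \<in> carrier_vec (n * (N + 1))"
      show "sample \<theta> n N (U x) = x"
      proof (rule block_vec_eqI[OF sample_carrier x])
        fix k i assume k: "k < N + 1" and i: "i < n"
        have "poly (U x $ i) (complex_of_real (\<theta> k)) =
            (\<Sum>k'\<le>N. if k' = k then x $ (n * k' + i) else 0)"
          unfolding U_def index_vec[OF i] poly_sum using k inj
          by (intro sum.cong) (auto simp: poly_lagrange_poly)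
        then show "sample \<theta> n N (U x) $ (n * k + i) = x $ (n * k + i)"
          using i k by (simp add: sample_index)
      qed
    qed
  qed (use U sample_carrier in blast)+
qed

text \<open>The \<open>\<complex>\<^sup>n\<close>-component comes last because the block row of \<open>colloc_A\<close> that carries the delay
  equation belongs to \<open>\<theta> N = 0\<close>.\<close>

definition tau_sample ::
  "(nat \<Rightarrow> real) \<Rightarrow> nat \<Rightarrow> nat \<Rightarrow> complex vec \<times> complex poly vec \<Rightarrow> complex vec" where
  "tau_sample \<theta> n N = (\<lambda>(a, g). sample \<theta> n (N - 1) g @\<^sub>v a)"

text \<open>The first \<open>N\<close> nodes determine a polynomial of degree at most
  \<open>N - 1\<close>, and the vector component fills the remaining block; \<open>N \<ge> 1\<close>
  makes \<open>N - 1 + 1\<close> equal to \<open>N\<close>.\<close>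

lemma bij_betw_tau_sample:
  assumes inj: "inj_on \<theta> {..N}" and N: "N \<ge> 1"
  shows "bij_betw (tau_sample \<theta> n N) (carrier_vec n \<times> vpolys n (N - 1)) (carrier_vec (n * (N + 1)))"
proof -
  have "inj_on \<theta> {..N - 1}" using inj by (rule inj_on_subset) auto
  from bij_betw_sample[OF this, of n]
  have b: "bij_betw (sample \<theta> n (N - 1)) (vpolys n (N - 1)) (carrier_vec (n * N))"
    using N by simp
  have s: "sample \<theta> n (N - 1) g \<in> carrier_vec (n * N)" for g
    using sample_carrier[of \<theta> n "N - 1" g] N by simp
  show ?thesis unfolding bij_betw_def
  proof
    show "inj_on (tau_sample \<theta> n N) (carrier_vec n \<times> vpolys n (N - 1))"
      using bij_betw_imp_inj_on[OF b] append_vec_eq[OF s s]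
      by (auto simp: inj_on_def tau_sample_def)
    show "tau_sample \<theta> n N ` (carrier_vec n \<times> vpolys n (N - 1)) = carrier_vec (n * (N + 1))"
    proof (intro equalityI subsetI)
      fix x assume "x \<in> tau_sample \<theta> n N ` (carrier_vec n \<times> vpolys n (N - 1))"
      then show "x \<in> carrier_vec (n * (N + 1))"
        using append_carrier_vec[OF s] by (fastforce simp: tau_sample_def add.commute)
    next
      fix x :: "complex vec" assume "x \<in> carrier_vec (n * (N + 1))"
      then have x: "x \<in> carrier_vec (n * N + n)" by (simp add: add.commute)
      have "vec_first x (n * N) \<in> sample \<theta> n (N - 1) ` vpolys n (N - 1)"
        using bij_betw_imp_surj_on[OF b] by simp
      then obtain g where g: "g \<in> vpolys n (N - 1)" "vec_first x (n * N) = sample \<theta> n (N - 1) g"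
        by auto
      then have "x = tau_sample \<theta> n N (vec_last x n, g)"
        using vec_first_last_append[OF x] by (simp add: tau_sample_def)
      then show "x \<in> tau_sample \<theta> n N ` (carrier_vec n \<times> vpolys n (N - 1))"
        using g by (intro image_eqI[of _ _ "(vec_last x n, g)"]) auto
    qed
  qed
qed

lemma tau_sample_index:
  assumes "N \<ge> 1" "i < n" "k < N + 1" "a \<in> carrier_vec n"
  shows "tau_sample \<theta> n N (a, g) $ (n * k + i) =
    (if k < N then poly (g $ i) (complex_of_real (\<theta> k)) else a $ i)"
proof -
  have s: "dim_vec (sample \<theta> n (N - 1) g) = n * N"
    using sample_carrier[of \<theta> n "N - 1" g] assms(1) by simp
  show ?thesis
  proof (cases "k < N")
    case True
    with block_index_less[OF assms(2) True] assms show ?thesis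
      by (simp add: tau_sample_def s[simplified] sample_index)
  next
    case False
    then have "k = N" using assms(3) by simp
    with assms show ?thesis by (simp add: tau_sample_def s[simplified])
  qed
qed

section \<open>Inner product, orthogonality and truncation\<close>

lemma ip_diff_smult_left:
  assumes "poly_inner_product ip"
  shows "ip (f - smult c g) h = ip f h - c * ip g h"
proof -
  have add: "ip (f + g) h = ip f h + ip g h" and smult: "ip (smult c f) g = c * ip f g" for f g h c
    using assms unfolding poly_inner_product_def by blast+
  show ?thesis using add[of f "smult (- c) g" h] smult[of "- c" g h] by simp
qed

lemma ip_zero_left:
  assumes "poly_inner_product ip"
  shows "ip 0 h = 0"
  using ip_diff_smult_left[OF assms, of 0 1 0 h] by simp

text \<open>Conjugate symmetry makes \<open>ip f f\<close> real and positivity makes it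
  non-negative, so squaring undoes the root. This rewrites the denominator in
  \<open>vtrunc\<close>.\<close>

lemma of_real_ip_norm_square:
  assumes "poly_inner_product ip"
  shows "complex_of_real ((ip_norm ip f)\<^sup>2) = ip f f"
proof -
  have herm: "ip f f = cnj (ip f f)" and pos: "f \<noteq> 0 \<Longrightarrow> Re (ip f f) > 0"
    using assms unfolding poly_inner_product_def by blast+
  have "Re (ip f f) \<ge> 0" using pos ip_zero_left[OF assms, of 0] by (cases "f = 0") auto
  then have "(ip_norm ip f)\<^sup>2 = Re (ip f f)" by (simp add: ip_norm_def)
  moreover have "Im (ip f f) = 0" using arg_cong[OF herm, of Im] by simp
  ultimately show ?thesis by (simp only: complex_eq_iff Re_complex_of_real Im_complex_of_real)
qed

text \<open>The degree condition does not exclude \<open>\<phi> 0 = 0\<close>, so non-vanishing is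
  taken from \<open>ip (\<phi> k) (\<phi> k)\<close>.\<close>

lemma coeff_orthogonal_neq_0:
  assumes "poly_inner_product ip" "degree_graded_orthogonal ip \<phi>"
  shows "coeff (\<phi> k) k \<noteq> 0"
proof -
  have "degree (\<phi> k) = k" "ip (\<phi> k) (\<phi> k) \<noteq> 0"
    using assms(2) unfolding degree_graded_orthogonal_def by auto
  moreover from this have "\<phi> k \<noteq> 0" using ip_zero_left[OF assms(1)] by metis
  ultimately show ?thesis using leading_coeff_0_iff[of "\<phi> k"] by simp
qed

text \<open>Induction on \<open>k\<close> removes the top coefficient of \<open>r\<close> by a
  multiple of \<open>\<phi> k\<close> with \<open>k < N\<close>, which is orthogonal to
  \<open>\<phi> N\<close>. Bounding by vanishing coefficients instead of the degree lets the
  induction start at \<open>r = 0\<close>.\<close>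

lemma ip_eq_0_if_coeffs_eq_0:
  assumes ip: "poly_inner_product ip" and orth: "degree_graded_orthogonal ip \<phi>"
    and "k \<le> N" "\<And>i. k \<le> i \<Longrightarrow> coeff r i = 0"
  shows "ip r (\<phi> N) = 0"
  using assms(3,4)
proof (induction k arbitrary: r)
  case 0
  then have "r = 0" by (intro poly_eqI) auto
  then show ?case by (simp add: ip_zero_left[OF ip])
next
  case (Suc k)
  have deg: "degree (\<phi> k) = k" and 0: "ip (\<phi> k) (\<phi> N) = 0"
    using orth Suc.prems(1) unfolding degree_graded_orthogonal_def by auto
  define c where "c = coeff r k / coeff (\<phi> k) k"
  have "coeff (r - smult c (\<phi> k)) i = 0" if "k \<le> i" for i
  proof (cases "i = k")
    case True
    then show ?thesis using coeff_orthogonal_neq_0[OF ip orth] by (simp add: c_def)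
  next
    case False
    then have "Suc k \<le> i" using that by simp
    then show ?thesis using Suc.prems(2) deg by (simp add: coeff_eq_0)
  qed
  then have "ip (r - smult c (\<phi> k)) (\<phi> N) = 0" using Suc.IH Suc.prems(1) by simp
  then show ?case by (simp add: ip_diff_smult_left[OF ip] 0)
qed

text \<open>Subtracting the multiple \<open>c\<close> of \<open>\<phi> N\<close> that cancels the
  coefficient of order \<open>N\<close> leaves a polynomial orthogonal to \<open>\<phi> N\<close>.
  As \<open>h\<close> is orthogonal too, \<open>c = 0\<close>, so that coefficient was already
  zero.\<close>

lemma degree_less_if_orthogonal:
  assumes ip: "poly_inner_product ip" and orth: "degree_graded_orthogonal ip \<phi>"
    and deg: "degree h \<le> N" and N: "N \<ge> 1" and h: "ip h (\<phi> N) = 0"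
  shows "degree h \<le> N - 1"
proof -
  have degN: "degree (\<phi> N) = N" and nz: "ip (\<phi> N) (\<phi> N) \<noteq> 0"
    using orth unfolding degree_graded_orthogonal_def by auto
  note nzc = coeff_orthogonal_neq_0[OF ip orth, of N]
  define c where "c = coeff h N / coeff (\<phi> N) N"
  have "coeff (h - smult c (\<phi> N)) i = 0" if "N \<le> i" for i
  proof (cases "i = N")
    case True
    then show ?thesis using nzc by (simp add: c_def)
  next
    case False
    then show ?thesis using that deg degN by (simp add: coeff_eq_0)
  qed
  then have "ip (h - smult c (\<phi> N)) (\<phi> N) = 0"
    by (rule ip_eq_0_if_coeffs_eq_0[OF ip orth order_refl])
  then have "c = 0" using h nz by (simp add: ip_diff_smult_left[OF ip])
  then have "coeff h N = 0" using nzc unfolding c_def by simp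
  then have "coeff h i = 0" if "i > N - 1" for i
    using that deg by (cases "i = N") (auto intro: coeff_eq_0)
  then show ?thesis by (intro degree_le) blast
qed

text \<open>The truncation removes the component along \<open>\<phi> N\<close>; what remains is
  orthogonal to \<open>\<phi> N\<close> and therefore loses its term of order
  \<open>N\<close>.\<close>

lemma degree_truncation:
  assumes ip: "poly_inner_product ip" and orth: "degree_graded_orthogonal ip \<phi>"
    and deg: "degree g \<le> N" and N: "N \<ge> 1"
  shows "degree (g - smult (ip g (\<phi> N) / complex_of_real ((ip_norm ip (\<phi> N))\<^sup>2)) (\<phi> N)) \<le> N - 1"
  unfolding of_real_ip_norm_square[OF ip]
proof (rule degree_less_if_orthogonal[OF ip orth _ N])
  have "degree (\<phi> N) = N" and nz: "ip (\<phi> N) (\<phi> N) \<noteq> 0"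
    using orth unfolding degree_graded_orthogonal_def by auto
  then show "degree (g - smult (ip g (\<phi> N) / ip (\<phi> N) (\<phi> N)) (\<phi> N)) \<le> N"
    using deg by (intro degree_diff_le order_trans[OF degree_smult_le]) auto
  show "ip (g - smult (ip g (\<phi> N) / ip (\<phi> N) (\<phi> N)) (\<phi> N)) (\<phi> N) = 0"
    using nz by (simp add: ip_diff_smult_left[OF ip])
qed

lemma vpolys_index:
  assumes "f \<in> vpolys n N" "i < n"
  shows "degree (f $ i) \<le> N"
  using assms by (simp add: vpolys_def)

section \<open>The tau operator in sampled coordinates\<close>

text \<open>Orthogonality enters through this lemma: it keeps the truncated polynomials in degree at
  most \<open>N - 1\<close>, where \<open>N\<close> nodes suffice to sample them faithfully.\<close>

lemma tau_operator_in_carrier: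
  assumes A: "A0 \<in> carrier_mat n n" "A1 \<in> carrier_mat n n"
    and ip: "poly_inner_product ip" and orth: "degree_graded_orthogonal ip \<phi>" and N: "N \<ge> 1"
    and f: "f \<in> vpolys n N"
  shows "tau_operator \<tau> A0 A1 ip \<phi> N s f \<in> carrier_vec n \<times> vpolys n (N - 1)"
proof -
  have dim: "dim_vec f = n" using f by (auto simp: vpolys_def)
  have "degree ([:s:] * (g - smult (ip g (\<phi> N) / complex_of_real ((ip_norm ip (\<phi> N))\<^sup>2)) (\<phi> N))
      - pderiv g) \<le> N - 1" if "degree g \<le> N" for g
  proof (rule degree_diff_le)
    show "degree ([:s:] * (g - smult (ip g (\<phi> N) / complex_of_real ((ip_norm ip (\<phi> N))\<^sup>2)) (\<phi> N)))
        \<le> N - 1"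
      using degree_truncation[OF ip orth that N]
      by (simp del: of_real_power)
    show "degree (pderiv g) \<le> N - 1" using that by (simp add: degree_pderiv diff_le_mono)
  qed
  then show ?thesis
    using A f dim by (auto simp: tau_operator_def vpolys_def vtrunc_def vderiv_def eval_at_def
      simp del: of_real_power)
qed

text \<open>Compared block by block: at a non-zero node the truncation is invisible and
  interpolation gives the derivative, while the last block, at node 0, is the delay
  equation.\<close>

lemma tau_sample_tau_operator:
  assumes A: "A0 \<in> carrier_mat n n" "A1 \<in> carrier_mat n n"
    and N: "N \<ge> 1" and inj: "inj_on \<theta> {..N}" and \<theta>N: "\<theta> N = 0"
    and zeros: "\<forall>k<N. poly (\<phi> N) (complex_of_real (\<theta> k)) = 0"
    and f: "f \<in> vpolys n N"
  shows "tau_sample \<theta> n N (tau_operator \<tau> A0 A1 ip \<phi> N s f) =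
    (s \<cdot>\<^sub>m 1\<^sub>m (n * (N + 1)) - colloc_A n \<tau> A0 A1 \<theta> N) *\<^sub>v sample \<theta> n N f"
    (is "?l = (s \<cdot>\<^sub>m ?I - ?A) *\<^sub>v ?v")
proof -
  have f': "f \<in> carrier_vec n" using f by (simp add: vpolys_def)
  have Ac: "?A \<in> carrier_mat (n * (N + 1)) (n * (N + 1))"
    unfolding colloc_A_def by (rule block_mat_carrier)
  have v: "?v \<in> carrier_vec (n * (N + 1))" by (rule sample_carrier)
  have M: "(s \<cdot>\<^sub>m ?I - ?A) *\<^sub>v ?v = s \<cdot>\<^sub>v ?v - ?A *\<^sub>v ?v"
  proof -
    have "(s \<cdot>\<^sub>m ?I) *\<^sub>v ?v = s \<cdot>\<^sub>v ?v"
      using v by (intro eq_vecI) (auto simp: scalar_prod_def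
        if_distrib[of "\<lambda>x. x * _"] if_distrib[of "\<lambda>x. _ * x"] cong: if_cong)
    then show ?thesis using minus_mult_distrib_mat_vec[OF _ Ac v, of "s \<cdot>\<^sub>m ?I"] by simp
  qed
  have E: "eval_at x f \<in> carrier_vec n" for x
    using f' by (simp add: eval_at_def)
  \<comment> \<open>The point \<open>- \<tau>\<close> need not be a node, so evaluation is expressed
    through node values, in the shape of the last block row of \<open>colloc_A\<close>.\<close>
  have Em: "(A *\<^sub>v eval_at x f) $ i =
      (\<Sum>k<N + 1. \<Sum>m<n. (poly (lagrange_poly \<theta> N k) (complex_of_real x) * A $$ (i, m)) * ?v $ (n * k + m))"
    if "A \<in> carrier_mat n n" "i < n" for A i x
  proof -
    have "(A *\<^sub>v eval_at x f) $ i = (\<Sum>m<n. A $$ (i, m) * poly (f $ m) (complex_of_real x))"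
      using that f' by (auto simp: eval_at_def scalar_prod_def lessThan_atLeast0 intro!: sum.cong)
    also have "\<dots> = (\<Sum>m<n. \<Sum>k<N + 1. (poly (lagrange_poly \<theta> N k) (complex_of_real x) * A $$ (i, m)) * ?v $ (n * k + m))"
    proof (intro sum.cong refl)
      fix m assume m: "m \<in> {..<n}"
      then have "degree (f $ m) \<le> N" using f by (simp add: vpolys_index)
      then show "A $$ (i, m) * poly (f $ m) (complex_of_real x) =
          (\<Sum>k<N + 1. (poly (lagrange_poly \<theta> N k) (complex_of_real x) * A $$ (i, m)) * ?v $ (n * k + m))"
        using m by (subst poly_lagrange_interpolation[OF inj])
          (auto simp: sum_distrib_left sample_index simp del: sum.lessThan_Suc intro!: sum.cong)
    qed
    also have "\<dots> = (\<Sum>k<N + 1. \<Sum>m<n. (poly (lagrange_poly \<theta> N k) (complex_of_real x) * A $$ (i, m)) * ?v $ (n * k + m))"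
      by (rule sum.swap)
    finally show ?thesis .
  qed
  obtain a g where L: "tau_operator \<tau> A0 A1 ip \<phi> N s f = (a, g)" by fastforce
  then have a: "a = s \<cdot>\<^sub>v eval_at 0 f - A0 *\<^sub>v eval_at 0 f - A1 *\<^sub>v eval_at (- \<tau>) f"
    and g: "g = [:s:] \<cdot>\<^sub>v vtrunc ip (\<phi> N) f - vderiv f"
    by (auto simp: tau_operator_def)
  have ac: "a \<in> carrier_vec n" using A E by (simp add: a)
  show ?thesis unfolding M L
  proof (rule block_vec_eqI[where n = n and K = "N + 1"])
    show "tau_sample \<theta> n N (a, g) \<in> carrier_vec (n * (N + 1))"
      using append_carrier_vec[OF sample_carrier[of \<theta> n "N - 1" g] ac] N
      by (simp add: tau_sample_def add.commute)
    show "s \<cdot>\<^sub>v ?v - ?A *\<^sub>v ?v \<in> carrier_vec (n * (N + 1))"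
      using Ac v by simp
  next
    fix j i assume j: "j < N + 1" and i: "i < n"
    note r = block_index_less[OF i j]
    have di: "degree (f $ i) \<le> N" using f i by (rule vpolys_index)
    have rhs: "(s \<cdot>\<^sub>v ?v - ?A *\<^sub>v ?v) $ (n * j + i) =
        s * poly (f $ i) (complex_of_real (\<theta> j)) - (?A *\<^sub>v ?v) $ (n * j + i)"
      using r Ac v i j by (simp add: sample_index del: index_mult_mat_vec)
    show "tau_sample \<theta> n N (a, g) $ (n * j + i) = (s \<cdot>\<^sub>v ?v - ?A *\<^sub>v ?v) $ (n * j + i)"
    proof (cases "j < N")
      case True
      have "(?A *\<^sub>v ?v) $ (n * j + i) =
          (\<Sum>k<N + 1. \<Sum>m<n. (poly (pderiv (lagrange_poly \<theta> N k)) (complex_of_real (\<theta> j)) \<cdot>\<^sub>m 1\<^sub>m n) $$ (i, m)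
             * ?v $ (n * k + m))"
        unfolding colloc_A_def using True by (subst block_mat_mult_vec_index[OF v i j]) simp
      also have "\<dots> = (\<Sum>k<N + 1. poly (pderiv (lagrange_poly \<theta> N k)) (complex_of_real (\<theta> j))
             * poly (f $ i) (complex_of_real (\<theta> k)))"
      proof (intro sum.cong refl)
        fix k assume k: "k \<in> {..<N + 1}"
        have "(\<Sum>m<n. (poly (pderiv (lagrange_poly \<theta> N k)) (complex_of_real (\<theta> j)) \<cdot>\<^sub>m 1\<^sub>m n) $$ (i, m)
             * ?v $ (n * k + m)) =
          (\<Sum>m<n. if m = i then poly (pderiv (lagrange_poly \<theta> N k)) (complex_of_real (\<theta> j))
             * poly (f $ m) (complex_of_real (\<theta> k)) else 0)"
          using i k by (intro sum.cong) (auto simp: sample_index)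
        then show "(\<Sum>m<n. (poly (pderiv (lagrange_poly \<theta> N k)) (complex_of_real (\<theta> j)) \<cdot>\<^sub>m 1\<^sub>m n) $$ (i, m)
             * ?v $ (n * k + m)) = poly (pderiv (lagrange_poly \<theta> N k)) (complex_of_real (\<theta> j))
             * poly (f $ i) (complex_of_real (\<theta> k))"
          using i by simp
      qed
      also have "\<dots> = poly (pderiv (f $ i)) (complex_of_real (\<theta> j))"
        by (rule poly_pderiv_lagrange_interpolation[OF inj di, symmetric])
      \<comment> \<open>By \<open>zeros\<close>, the multiple of \<open>\<phi> N\<close> subtracted
        in \<open>vtrunc\<close> vanishes at this node, whatever its coefficient.\<close>
      finally show ?thesis unfolding rhs
        using True i f' zeros
        by (simp add: tau_sample_index[OF N i j ac] g vtrunc_def vderiv_def)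
    next
      case False
      then have jN: "j = N" using j by simp
      have "(?A *\<^sub>v ?v) $ (n * j + i) =
          (\<Sum>k<N + 1. \<Sum>m<n. (poly (lagrange_poly \<theta> N k) 0 \<cdot>\<^sub>m A0
             + poly (lagrange_poly \<theta> N k) (complex_of_real (- \<tau>)) \<cdot>\<^sub>m A1) $$ (i, m) * ?v $ (n * k + m))"
        unfolding colloc_A_def using jN by (subst block_mat_mult_vec_index[OF v i j]) simp
      also have "\<dots> = (A0 *\<^sub>v eval_at 0 f) $ i + (A1 *\<^sub>v eval_at (- \<tau>) f) $ i"
        unfolding Em[OF A(1) i] Em[OF A(2) i] sum.distrib[symmetric] using A i
        by (intro sum.cong refl) (simp add: algebra_simps)
      finally have "(?A *\<^sub>v ?v) $ (n * j + i) =
          (A0 *\<^sub>v eval_at 0 f) $ i + (A1 *\<^sub>v eval_at (- \<tau>) f) $ i" .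
      moreover have "tau_sample \<theta> n N (a, g) $ (n * j + i) = a $ i"
        using False by (simp only: tau_sample_index[OF N i j ac] if_False)
      moreover have "eval_at 0 f $ i = poly (f $ i) (complex_of_real (\<theta> j))"
        using i f' jN \<theta>N by (simp add: eval_at_def)
      ultimately show ?thesis unfolding rhs
        using A i E[of 0] by (simp add: a del: index_mult_mat_vec)
    qed
  qed
qed

section \<open>Equality of the transfer functions\<close>

theorem theorem4p1:
  fixes n p q N :: nat
    and \<tau> :: real
    and A0 A1 B C :: "complex mat"
    and ip :: "complex poly \<Rightarrow> complex poly \<Rightarrow> complex"
    and \<phi> :: "nat \<Rightarrow> complex poly"
    and \<theta> :: "nat \<Rightarrow> real"
    and s :: complex
  assumes "\<tau> > 0"
    and "A0 \<in> carrier_mat n n" and "A1 \<in> carrier_mat n n"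
    and "B \<in> carrier_mat n p" and "C \<in> carrier_mat q n"
    and "N \<ge> 1"
    and "poly_inner_product ip"
    and "degree_graded_orthogonal ip \<phi>"
    and "- \<tau> \<le> \<theta> 0" and "strict_mono_on {0..N} \<theta>" and "\<theta> N = 0"
    and "\<forall>k<N. poly (\<phi> N) (complex_of_real (\<theta> k)) = 0"
  shows "colloc_transfer n p q \<tau> A0 A1 B C \<theta> N s = tau_transfer n p q \<tau> A0 A1 B C ip \<phi> N s"
proof -
  have inj: "inj_on \<theta> {..N}"
    using strict_mono_on_imp_inj_on[OF assms(10)] by (simp add: atLeast0AtMost)
  define K where "K = n * (N + 1)"
  define L where "L = tau_operator \<tau> A0 A1 ip \<phi> N s"
  define M where "M = s \<cdot>\<^sub>m 1\<^sub>m K - colloc_A n \<tau> A0 A1 \<theta> N"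
  have M: "M \<in> carrier_mat K K"
    unfolding M_def K_def colloc_A_def using block_mat_carrier by auto
  let ?V = "sample \<theta> n N" and ?W = "tau_sample \<theta> n N"
  let ?X = "vpolys n N" and ?Y = "carrier_vec n \<times> vpolys n (N - 1)"
  have V: "bij_betw ?V ?X (carrier_vec K)" unfolding K_def by (rule bij_betw_sample[OF inj])
  have W: "bij_betw ?W ?Y (carrier_vec K)"
    unfolding K_def by (rule bij_betw_tau_sample[OF inj assms(6)])
  \<comment> \<open>The operator \<open>L\<close> and the matrix \<open>M\<close> are intertwined by
    the two sampling bijections; both definedness and values follow from this.\<close>
  have WL: "?W (L f) = M *\<^sub>v ?V f" if "f \<in> ?X" for f
    unfolding L_def M_def K_def
    by (rule tau_sample_tau_operator[where \<phi> = \<phi>, OF assms(2,3,6) inj assms(11,12) that])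
  have "L ` ?X \<subseteq> ?Y"
    unfolding L_def using tau_operator_in_carrier[OF assms(2,3,7,8,6)] by blast
  \<comment> \<open>Composing with bijections preserves bijectivity, so the two transfer functions
    are defined at the same \<open>s\<close>.\<close>
  then have "bij_betw L ?X ?Y \<longleftrightarrow> bij_betw (?W \<circ> L) ?X (carrier_vec K)"
    by (rule bij_betw_comp_iff2[OF W])
  also have "\<dots> \<longleftrightarrow> bij_betw ((\<lambda>x. M *\<^sub>v x) \<circ> ?V) ?X (carrier_vec K)"
    by (rule bij_betw_cong) (simp add: WL)
  also have "\<dots> \<longleftrightarrow> bij_betw (\<lambda>x. M *\<^sub>v x) (carrier_vec K) (carrier_vec K)"
    by (rule bij_betw_comp_iff[OF V, symmetric])
  also have "\<dots> \<longleftrightarrow> mat_inverse M \<noteq> None"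
    by (rule mat_inverse_Some_iff_bij[OF M, symmetric])
  finally have iff: "bij_betw L ?X ?Y \<longleftrightarrow> mat_inverse M \<noteq> None" .
  show ?thesis
  proof (cases "mat_inverse M")
    case None
    then show ?thesis
      using iff by (simp add: colloc_transfer_def tau_transfer_def L_def M_def K_def)
  next
    case (Some R)
    with iff have L: "bij_betw L ?X ?Y" by simp
    have R: "R * M = 1\<^sub>m K" "R \<in> carrier_mat K K" using mat_inverse(2)[OF M Some] by auto
    let ?B = "colloc_B n p B N" and ?C = "colloc_C n q C N"
    have Bc: "?B \<in> carrier_mat K p"
      unfolding colloc_B_def K_def using block_mat_carrier[of n p "N + 1" 1] by simp
    have Cc: "?C \<in> carrier_mat q K"
      unfolding colloc_C_def K_def using block_mat_carrier[of q n 1 "N + 1"] by simp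
    have "?C * R * ?B = mat q p (\<lambda>(i, j).
        (C *\<^sub>v eval_at 0 (the_inv_into ?X L (B *\<^sub>v unit_vec p j, 0\<^sub>v n))) $ i)" (is "_ = ?G")
    proof (rule eq_matI)
      fix i j assume "i < dim_row ?G" "j < dim_col ?G"
      then have i: "i < q" and j: "j < p" by auto
      define b where "b = B *\<^sub>v unit_vec p j"
      have b: "b \<in> carrier_vec n" using assms(4) by (simp add: b_def)
      have bcol: "b = col B j" using assms(4) j by (auto simp: b_def)
      \<comment> \<open>\<open>f\<close> is the tau response to the \<open>j\<close>-th unit input;
        its samples will turn out to be column \<open>j\<close> of \<open>R * ?B\<close>.\<close>
      define f where "f = the_inv_into ?X L (b, 0\<^sub>v n)"
      have "(b, 0\<^sub>v n) \<in> ?Y" using b by (simp add: vpolys_def)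
      then have f: "f \<in> ?X" "L f = (b, 0\<^sub>v n)"
        using L the_inv_into_into[OF bij_betw_imp_inj_on[OF L] _ order_refl, of "(b, 0\<^sub>v n)"]
          f_the_inv_into_f_bij_betw[OF L, of "(b, 0\<^sub>v n)"]
        by (auto simp: f_def bij_betw_def)
      have fc: "f \<in> carrier_vec n" using f by (simp add: vpolys_def)
      have Vc: "?V f \<in> carrier_vec K" unfolding K_def by (rule sample_carrier)
      \<comment> \<open>The zero polynomial samples to the \<open>N\<close> zero blocks of
        \<open>colloc_B\<close>, and \<open>b\<close> occupies the last block.\<close>
      have "?W (b, 0\<^sub>v n) = col ?B j"
      proof (rule block_vec_eqI[where n = n and K = "N + 1"])
        show "?W (b, 0\<^sub>v n) \<in> carrier_vec (n * (N + 1))"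
          using WL[OF f(1)] M Vc unfolding f(2) K_def by simp
        show "col ?B j \<in> carrier_vec (n * (N + 1))" using Bc j by (auto simp: K_def)
        fix k m assume k: "k < N + 1" and m: "m < n"
        \<comment> \<open>There is a single block column, of index 0; writing \<open>j\<close> as
          \<open>p * 0 + j\<close> fits \<open>block_mat_index\<close>.\<close>
        have "?B $$ (n * k + m, p * 0 + j) = (if k = N then B else 0\<^sub>m n p) $$ (m, j)"
          unfolding colloc_B_def by (rule block_mat_index[OF m j k]) simp
        then have "col ?B j $ (n * k + m) = (if k < N then 0 else b $ m)"
          using block_index_less[OF m k] k m j Bc assms(4) by (auto simp: bcol K_def)
        then show "?W (b, 0\<^sub>v n) $ (n * k + m) = col ?B j $ (n * k + m)"
          using m by (simp only: tau_sample_index[OF assms(6) m k b]) simp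
      qed
      then have MV: "M *\<^sub>v ?V f = col ?B j" using WL[OF f(1)] f(2) by simp
      have "R *\<^sub>v col ?B j = ?V f"
        unfolding MV[symmetric] using R M Vc by (simp flip: assoc_mult_mat_vec)
      then have "col (R * ?B) j = ?V f" using col_mult2[OF R(2) Bc j] by simp
      then have "(?C * (R * ?B)) $$ (i, j) = (?C *\<^sub>v ?V f) $ i"
        using i j R(2) Bc Cc by simp
      also have "\<dots> = (\<Sum>k<N + 1. \<Sum>m<n. (if k = N then C else 0\<^sub>m q n) $$ (i, m) * ?V f $ (n * k + m))"
        unfolding colloc_C_def
        using block_mat_mult_vec_index[of "?V f" n "N + 1" i q 0 1] Vc i by (simp add: K_def)
      \<comment> \<open>Only the block \<open>k = N\<close> survives, and
        \<open>\<theta> N = 0\<close> turns its samples into values at 0.\<close>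
      also have "\<dots> = (\<Sum>m<n. C $$ (i, m) * poly (f $ m) 0)"
        using i by (simp add: sample_index assms(11))
      also have "\<dots> = (C *\<^sub>v eval_at 0 f) $ i"
        using i assms(5) fc
        by (auto simp: eval_at_def scalar_prod_def lessThan_atLeast0 intro!: sum.cong)
      finally show "(?C * R * ?B) $$ (i, j) = ?G $$ (i, j)"
        using i j assoc_mult_mat[OF Cc R(2) Bc] by (simp add: f_def b_def)
    qed (use Bc Cc R in auto)
    then show ?thesis
      using Some L by (simp add: colloc_transfer_def tau_transfer_def L_def M_def K_def Let_def)
  qed
qed

end
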